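(* Let the labor flow networks of two economies with the same parameters have adjacency matrices $\mathbf{A}$ and $\mathbf{A}'$, degree distributions $P$ and $P'$, and aggregate unemployment rates $u=\sum_{k=1}^{k_{\max}} u_k P(k)$ and $u'=\sum_{k=1}^{k_{\max}} u_k P'(k)$, where $$u_k=\frac{\lambda}{\lambda +h^*[1-(1-v)^{k}]}$$ is the firm-specific unemployment rate of a firm of degree $k$. If $P$ strictly first-order stochastically dominates $P'$, then $u<u'$.
   Context: A labor flow network is a finite connected undirected graph without self-loops whose nodes are firms; its degree distribution $P$ is the probability distribution on $\{1,\dots,k_{\max}\}$ in which $P(k)$ is the fraction of firms with degree $k$ ($k_{\max}$ is an upper bound for the degrees in both networks). Parameters common to both economies: separation probability $\lambda\in(0,1)$, investment probability $v\in(0,1)$, productivity $y$, exogenous wage $w<y$, cost parameters $c\in(0,1)$, $\kappa\in[0,1]$. All firms set the same optimal hiring policy $h^*=\frac{\psi}{2\phi}(y-w)$, where $\psi=1-\lambda+v\lambda$ and $\phi=c(v+\kappa-v\kappa)$; it is a probability, so $0<h^*\le 1$, and does not depend on the degree or on the network. $P$ strictly first-order stochastically dominates $P'$ if $\sum_{j\le k}P(j)\le\sum_{j\le k}P'(j)$ for all $k$, with strict inequality for at least one $k$. *)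

theory Defs
  imports "HOL-Analysis.Analysis" "Graph_Theory.Pair_Digraph" "Graph_Theory.Digraph_Component"
begin

text \<open>A network on the firms \<open>'n\<close> is given by its adjacency matrix. Undirected edges are pairs of
  opposite arcs, so \<open>pair_graph\<close> below says: finite, undirected, without self-loops.\<close>

definition network_graph :: "nat ^ 'n ^ 'n \<Rightarrow> 'n pair_pre_digraph" where
  "network_graph A = \<lparr> pverts = UNIV, parcs = {(i, j). A $ i $ j = 1} \<rparr>"

lemma pair_graph_network_graph_iff:
  fixes A :: "nat ^ 'n ^ 'n"
  assumes "\<forall>i j. A $ i $ j \<in> {0, 1}"
  shows "pair_graph (network_graph A) \<longleftrightarrow> transpose A = A \<and> (\<forall>i. A $ i $ i = 0)"
proof
  assume G: "pair_graph (network_graph A)"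
  then interpret pair_graph "network_graph A" .
  have "A $ i $ j = 1 \<Longrightarrow> A $ j $ i = 1" for i j
    using arcs_symmetric[of i j] by (simp add: network_graph_def)
  then have "A $ i $ j = A $ j $ i" for i j
    using assms by (metis empty_iff insert_iff)
  moreover have "A $ i $ i = 0" for i
    using no_loops'[of i i] assms by (force simp: network_graph_def)
  ultimately show "transpose A = A \<and> (\<forall>i. A $ i $ i = 0)"
    by (auto simp: transpose_def vec_eq_iff)
next
  assume R: "transpose A = A \<and> (\<forall>i. A $ i $ i = 0)"
  then have "A $ i $ j = A $ j $ i" for i j
    by (metis transpose_def vec_lambda_beta)
  then show "pair_graph (network_graph A)"
    using R by unfold_locales
      (auto simp: network_graph_def symmetric_def arcs_ends_def arc_to_ends_def with_proj_def intro!: symI)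
qed

definition labor_flow_network :: "nat ^ 'n ^ 'n \<Rightarrow> bool" where
  "labor_flow_network A \<longleftrightarrow>
     (\<forall>i j. A $ i $ j \<in> {0, 1}) \<and>
     pair_graph (network_graph A) \<and>
     Digraph_Component.connected (with_proj (network_graph A))"

definition firm_degree :: "nat ^ 'n ^ 'n \<Rightarrow> 'n \<Rightarrow> nat" where
  "firm_degree A i = (\<Sum>j\<in>UNIV. A $ i $ j)"

definition degree_distribution :: "nat ^ 'n ^ 'n \<Rightarrow> nat \<Rightarrow> real" where
  "degree_distribution A k = real (card {i. firm_degree A i = k}) / real CARD('n)"

lemma degree_distribution_sum:
  fixes A :: "nat ^ 'n ^ 'n"
  assumes "\<forall>i. firm_degree A i \<in> {1..kmax}"
  shows "(\<Sum>k=1..kmax. degree_distribution A k) = 1"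
proof -
  have "(\<Sum>k=1..kmax. card {i. firm_degree A i = k}) = card (\<Union>k\<in>{1..kmax}. {i. firm_degree A i = k})"
    by (subst card_UN_disjoint) auto
  also have "(\<Union>k\<in>{1..kmax}. {i. firm_degree A i = k}) = UNIV"
    using assms by auto
  finally have "(\<Sum>k=1..kmax. real (card {i. firm_degree A i = k})) = real CARD('n)"
    by (metis of_nat_sum)
  then show ?thesis
    by (simp add: degree_distribution_def flip: sum_divide_distrib)
qed

text \<open>Strict first-order stochastic dominance of distributions on \<open>{1..kmax}\<close>.\<close>

definition strictly_fosd :: "nat \<Rightarrow> (nat \<Rightarrow> real) \<Rightarrow> (nat \<Rightarrow> real) \<Rightarrow> bool" where
  "strictly_fosd kmax P P' \<longleftrightarrow>
     (\<forall>k\<in>{1..kmax}. (\<Sum>j=1..k. P j) \<le> (\<Sum>j=1..k. P' j)) \<and>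
     (\<exists>k\<in>{1..kmax}. (\<Sum>j=1..k. P j) < (\<Sum>j=1..k. P' j))"

definition psi :: "real \<Rightarrow> real \<Rightarrow> real" where
  "psi lam v = 1 - lam + v * lam"

definition phi :: "real \<Rightarrow> real \<Rightarrow> real \<Rightarrow> real" where
  "phi c v kap = c * (v + kap - v * kap)"

definition optimal_hiring_policy :: "real \<Rightarrow> real \<Rightarrow> real \<Rightarrow> real \<Rightarrow> real \<Rightarrow> real \<Rightarrow> real" where
  "optimal_hiring_policy lam v y w c kap = psi lam v / (2 * phi c v kap) * (y - w)"

definition firm_unemployment_rate :: "real \<Rightarrow> real \<Rightarrow> real \<Rightarrow> nat \<Rightarrow> real" where
  "firm_unemployment_rate lam v h k = lam / (lam + h * (1 - (1 - v) ^ k))"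

definition aggregate_unemployment_rate ::
  "nat \<Rightarrow> real \<Rightarrow> real \<Rightarrow> real \<Rightarrow> (nat \<Rightarrow> real) \<Rightarrow> real" where
  "aggregate_unemployment_rate kmax lam v h P =
     (\<Sum>k=1..kmax. firm_unemployment_rate lam v h k * P k)"

end

theory Submission
  imports Defs
begin

text \<open>The rate \<open>u\<^sub>k\<close> is strictly decreasing in \<open>k\<close>. Summation by parts writes \<open>\<Sum>k. u\<^sub>k P(k)\<close> as
  the value of \<open>u\<^sub>k\<close> at \<open>k = kmax\<close> plus a combination of the cumulative sums of \<open>P\<close> with positive weights \<open>u\<^sub>k - u\<^sub>k\<^sub>+\<^sub>1\<close>, so the
  ordering of the cumulative sums carries over to the aggregate rates.\<close>

lemma sum_mult_by_parts:
  fixes f p :: "nat \<Rightarrow> 'a::comm_ring"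
  shows "(\<Sum>k=1..n. f k * p k) = f n * (\<Sum>j=1..n. p j) + (\<Sum>k=1..<n. (f k - f (Suc k)) * (\<Sum>j=1..k. p j))"
  \<comment> \<open>For \<open>n\<close> at least 1, passing to \<open>Suc n\<close> adds the weight
    \<open>f n - f (Suc n)\<close> on the \<open>n\<close>-th cumulative sum, which turns its
    coefficient \<open>f n\<close> into \<open>f (Suc n)\<close>.\<close>
  by (induction n) (auto simp: algebra_simps atLeastLessThanSuc)

text \<open>Equal totals make the boundary terms after summation by parts agree, so only the
  positively weighted cumulative sums are compared.\<close>

lemma strictly_fosd_sum_mult_less:
  fixes f :: "nat \<Rightarrow> real"
  assumes f: "strict_antimono_on {1..n} f"
    and total: "(\<Sum>j=1..n. P j) = (\<Sum>j=1..n. P' j)"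
    and fosd: "strictly_fosd n P P'"
  shows "(\<Sum>k=1..n. f k * P k) < (\<Sum>k=1..n. f k * P' k)"
proof -
  have dec: "f (Suc k) < f k" if "k \<in> {1..<n}" for k
    using that monotone_onD[OF f, of k "Suc k"] by auto
  obtain m where m: "m \<in> {1..n}" "(\<Sum>j=1..m. P j) < (\<Sum>j=1..m. P' j)"
    using fosd by (auto simp: strictly_fosd_def)
  \<comment> \<open>The weights stop at \<open>n - 1\<close>, so the strict inequality must occur
    before \<open>n\<close>; at \<open>n\<close> the totals agree.\<close>
  have "m \<noteq> n"
    using m total by auto
  then have m': "m \<in> {1..<n}"
    using m by auto
  have "(\<Sum>k=1..<n. (f k - f (Suc k)) * (\<Sum>j=1..k. P j))
      < (\<Sum>k=1..<n. (f k - f (Suc k)) * (\<Sum>j=1..k. P' j))"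
  proof (rule sum_strict_mono_ex1)
    show "\<forall>k\<in>{1..<n}. (f k - f (Suc k)) * (\<Sum>j=1..k. P j) \<le> (f k - f (Suc k)) * (\<Sum>j=1..k. P' j)"
      using dec fosd by (auto simp: strictly_fosd_def less_imp_le intro!: mult_left_mono)
    show "\<exists>k\<in>{1..<n}. (f k - f (Suc k)) * (\<Sum>j=1..k. P j) < (f k - f (Suc k)) * (\<Sum>j=1..k. P' j)"
      using dec[OF m'] m m' by (intro bexI[of _ m] mult_strict_left_mono) auto
  qed simp
  then show ?thesis
    unfolding sum_mult_by_parts total by simp
qed

lemma firm_unemployment_rate_strict_antimono:
  assumes "0 < lam" "0 < v" "v < 1" "0 < h"
  shows "strict_antimono_on S (firm_unemployment_rate lam v h)"
proof (rule monotone_onI)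
  fix j k :: nat
  assume "j < k"
  then have "(1 - v) ^ k < (1 - v) ^ j"
    using assms by (intro power_strict_decreasing) auto
  \<comment> \<open>This keeps both denominators at least \<open>lam\<close>, hence
    positive.\<close>
  moreover have "(1 - v) ^ i \<le> 1" for i
    using assms by (intro power_le_one) auto
  ultimately show "firm_unemployment_rate lam v h k < firm_unemployment_rate lam v h j"
    unfolding firm_unemployment_rate_def using assms
    by (intro divide_strict_left_mono mult_pos_pos add_pos_nonneg) auto
qed

theorem proposition5:
  fixes A :: "nat ^ 'n ^ 'n" and A' :: "nat ^ 'm ^ 'm"
    and kmax :: nat
    and lam v y w c kap h u u' :: real
    and P P' :: "nat \<Rightarrow> real"
  assumes "0 < lam" "lam < 1"
    and "0 < v" "v < 1"
    and "w < y"
    and "0 < c" "c < 1"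
    and "0 \<le> kap" "kap \<le> 1"
    and "h = optimal_hiring_policy lam v y w c kap"
    and "0 < h" "h \<le> 1"
    and "labor_flow_network A" "labor_flow_network A'"
    and "\<forall>i. firm_degree A i \<in> {1..kmax}"
    and "\<forall>i. firm_degree A' i \<in> {1..kmax}"
    and "P = degree_distribution A"
    and "P' = degree_distribution A'"
    and "u = aggregate_unemployment_rate kmax lam v h P"
    and "u' = aggregate_unemployment_rate kmax lam v h P'"
    and "strictly_fosd kmax P P'"
  shows "u < u'"
proof -
  \<comment> \<open>Both sums are 1, since all degrees lie in \<open>{1..kmax}\<close>.\<close>
  have "(\<Sum>k=1..kmax. P k) = (\<Sum>k=1..kmax. P' k)"
    unfolding \<open>P = _\<close> \<open>P' = _\<close> by (simp only: assms(15,16)[THEN degree_distribution_sum])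
  with assms(1-4,11,21) show ?thesis
    unfolding \<open>u = _\<close> \<open>u' = _\<close> aggregate_unemployment_rate_def
    by (intro strictly_fosd_sum_mult_less firm_unemployment_rate_strict_antimono)
qed

end
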